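(* There exists an algorithm, with running time polynomial in $n$, that takes as input $m,n\in\mathbb{N}$ with $m\le n$ and a zero-set $\mathcal{Z}$ with $\mathcal{Z}\subseteq R_{n,m}$, and returns a number in the interval $[\gamma,3\gamma]$, where $\gamma=\gamma(\mathcal{Z},m,n)$.
   Context: $\mathbb{Z}_+=\{0,1,2,\dots\}$, $\mathbb{N}=\{1,2,\dots\}$, $[0,c]=\{0,1,\dots,c\}$, and $R_{a,b}=[0,a-1]\times[0,b-1]$. A zero-set (Young diagram) is a downward-closed set $\mathcal{Z}\subseteq\mathbb{Z}_+^2$. For $m,n\in\mathbb{N}$, the graph $K_m\Box K_n$ is represented on the vertex set $R_{n,m}=[0,n-1]\times[0,m-1]$, with two vertices adjacent iff they differ in exactly one coordinate. For $v=(j,i)\in R_{n,m}$, the row neighborhood $\mathcal{N}^r(v)$ is the set of all $(j',i)\in R_{n,m}$ with $j'\neq j$, and the column neighborhood $\mathcal{N}^c(v)$ is the set of all $(j,i')\in R_{n,m}$ with $i'\ne i$. Given $\mathcal{Z}$, for $A\subseteq R_{n,m}$ let $\mathcal{T}(A)=A\cup\{v\in R_{n,m}\setminus A\colon (|\mathcal{N}^r(v)\cap A|,|\mathcal{N}^c(v)\cap A|)\notin\mathcal{Z}\}$. Then $\gamma(\mathcal{Z},m,n)=\min\{|A|\colon A\subseteq R_{n,m},\ \mathcal{T}(A)=R_{n,m}\}$. *)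

theory Defs
  imports "HOL-Computational_Algebra.Polynomial"
begin

section \<open>Young domination on Hamming rectangles\<close>

definition zero_set :: "(nat \<times> nat) set \<Rightarrow> bool" where
  "zero_set Z \<longleftrightarrow> (\<forall>x y x' y'. (x, y) \<in> Z \<longrightarrow> x' \<le> x \<longrightarrow> y' \<le> y \<longrightarrow> (x', y') \<in> Z)"

definition rect :: "nat \<Rightarrow> nat \<Rightarrow> (nat \<times> nat) set" where
  "rect a b = {..<a} \<times> {..<b}"

text \<open>As in \<open>rect n m\<close>, the parameters of the following definitions are the number \<open>n\<close> of
  columns and the number \<open>m\<close> of rows, in this order; this is the vertex set of
  \<open>K\<^sub>m \<box> K\<^sub>n\<close>.\<close>

definition row_nbhd :: "nat \<Rightarrow> nat \<Rightarrow> nat \<times> nat \<Rightarrow> (nat \<times> nat) set" where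
  "row_nbhd n m v = {w \<in> rect n m. snd w = snd v \<and> fst w \<noteq> fst v}"

definition col_nbhd :: "nat \<Rightarrow> nat \<Rightarrow> nat \<times> nat \<Rightarrow> (nat \<times> nat) set" where
  "col_nbhd n m v = {w \<in> rect n m. fst w = fst v \<and> snd w \<noteq> snd v}"

definition growth :: "(nat \<times> nat) set \<Rightarrow> nat \<Rightarrow> nat \<Rightarrow> (nat \<times> nat) set \<Rightarrow> (nat \<times> nat) set" where
  "growth Z n m A = A \<union> {v \<in> rect n m - A.
     (card (row_nbhd n m v \<inter> A), card (col_nbhd n m v \<inter> A)) \<notin> Z}"

definition gamma :: "(nat \<times> nat) set \<Rightarrow> nat \<Rightarrow> nat \<Rightarrow> nat" where
  "gamma Z m n = Min (card ` {A. A \<subseteq> rect n m \<and> growth Z n m A = rect n m})"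

text \<open>The minimum is attained, as \<open>Min\<close> is taken over a finite nonempty set.\<close>

lemma gamma_set:
  "finite (card ` {A. A \<subseteq> rect n m \<and> growth Z n m A = rect n m})"
  "card ` {A. A \<subseteq> rect n m \<and> growth Z n m A = rect n m} \<noteq> {}"
proof -
  have "finite {A. A \<subseteq> rect n m}"
    by (simp add: rect_def)
  then show "finite (card ` {A. A \<subseteq> rect n m \<and> growth Z n m A = rect n m})"
    by (intro finite_imageI) (rule rev_finite_subset, auto)
  have "growth Z n m (rect n m) = rect n m"
    by (auto simp: growth_def)
  then show "card ` {A. A \<subseteq> rect n m \<and> growth Z n m A = rect n m} \<noteq> {}"
    by blast
qed

section \<open>Random access machines\<close>

text \<open>
  Algorithms are programs of a random access machine in the style of Cook and Reckhow, with
  structured control flow instead of jumps.  A state consists of registers, addressed by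
  constants of the program, and of a memory, addressed indirectly through registers; both hold
  natural numbers.  Every executed instruction and every evaluated test takes one unit of time.
  The unit-cost measure is polynomially equivalent to Turing machine time because the only
  arithmetic operations are addition and (truncated) subtraction: by \<open>exec_bounded\<close> below, the
  bit length of the numbers grows by at most one per unit of time.
\<close>

type_synonym state = "(nat \<Rightarrow> nat) \<times> (nat \<Rightarrow> nat)"

datatype prog =
    Const nat nat
  | Add nat nat nat
  | Sub nat nat nat
  | Load nat nat
  | Store nat nat
  | Seq prog prog
  | Cond nat prog prog
  | While nat prog

text \<open>\<open>exec c s t s'\<close>: started in \<open>s\<close>, the program \<open>c\<close> halts in \<open>s'\<close> after \<open>t\<close> units of time.\<close>

inductive exec :: "prog \<Rightarrow> state \<Rightarrow> nat \<Rightarrow> state \<Rightarrow> bool" where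
  Const: "exec (Const i k) (r, h) 1 (r(i := k), h)"
| Add: "exec (Add i j k) (r, h) 1 (r(i := r j + r k), h)"
| Sub: "exec (Sub i j k) (r, h) 1 (r(i := r j - r k), h)"
| Load: "exec (Load i j) (r, h) 1 (r(i := h (r j)), h)"
| Store: "exec (Store i j) (r, h) 1 (r, h(r i := r j))"
| Seq: "exec c s t s' \<Longrightarrow> exec d s' u s'' \<Longrightarrow> exec (Seq c d) s (t + u) s''"
| Cond_True: "r i > 0 \<Longrightarrow> exec c (r, h) t s' \<Longrightarrow> exec (Cond i c d) (r, h) (1 + t) s'"
| Cond_False: "r i = 0 \<Longrightarrow> exec d (r, h) t s' \<Longrightarrow> exec (Cond i c d) (r, h) (1 + t) s'"
| While_False: "r i = 0 \<Longrightarrow> exec (While i c) (r, h) 1 (r, h)"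
| While_True: "r i > 0 \<Longrightarrow> exec c (r, h) t s' \<Longrightarrow> exec (While i c) s' u s'' \<Longrightarrow>
    exec (While i c) (r, h) (1 + t + u) s''"

inductive_cases exec_elims:
  "exec (Const i k) s t s'" "exec (Add i j k) s t s'" "exec (Sub i j k) s t s'"
  "exec (Load i j) s t s'" "exec (Store i j) s t s'" "exec (Seq c d) s t s'"
  "exec (Cond i c d) s t s'" "exec (While i c) s t s'"

lemma exec_deterministic:
  assumes "exec c s t s'" and "exec c s u s''"
  shows "t = u \<and> s' = s''"
  using assms
proof (induction arbitrary: u s'' rule: exec.induct)
  case (Seq c s t s' d u' s1)
  from Seq.prems show ?case
    by (rule exec_elims(6)) (use Seq.IH in blast)
next
  case (Cond_True r i c h t s' d)
  from Cond_True.prems Cond_True.hyps(1)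
  obtain v where "u = 1 + v" "exec c (r, h) v s''"
    by (auto elim: exec_elims(7))
  with Cond_True.IH show ?case by blast
next
  case (Cond_False r i d h t s' c)
  from Cond_False.prems Cond_False.hyps(1)
  obtain v where "u = 1 + v" "exec d (r, h) v s''"
    by (auto elim: exec_elims(7))
  with Cond_False.IH show ?case by blast
next
  case (While_False r i c h)
  from While_False.prems show ?case
    by (rule exec_elims(8)) (use While_False.hyps in simp_all)
next
  case (While_True r i c h t s' v s1)
  from While_True.prems
  obtain t' s2 v' where "u = 1 + t' + v'" "exec c (r, h) t' s2" "exec (While i c) s2 v' s''"
    by (rule exec_elims(8)) (use While_True.hyps(1) in auto)
  with While_True.IH show ?case by blast
qed (erule exec_elims(1-5), simp)+

fun consts_le :: "nat \<Rightarrow> prog \<Rightarrow> bool" where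
  "consts_le B (Const i k) \<longleftrightarrow> k \<le> B"
| "consts_le B (Seq c d) \<longleftrightarrow> consts_le B c \<and> consts_le B d"
| "consts_le B (Cond i c d) \<longleftrightarrow> consts_le B c \<and> consts_le B d"
| "consts_le B (While i c) \<longleftrightarrow> consts_le B c"
| "consts_le B c \<longleftrightarrow> True"

definition state_le :: "nat \<Rightarrow> state \<Rightarrow> bool" where
  "state_le B s \<longleftrightarrow> (\<forall>i. fst s i \<le> B) \<and> (\<forall>a. snd s a \<le> B)"

lemma state_le_mono: "state_le B s \<Longrightarrow> B \<le> C \<Longrightarrow> state_le C s"
  unfolding state_le_def by (meson le_trans)

lemma consts_le_mono: "consts_le B c \<Longrightarrow> B \<le> C \<Longrightarrow> consts_le C c"
  by (induction c) auto

lemma exec_bounded: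
  assumes "exec c s t s'" and "consts_le B c" and "state_le B s"
  shows "state_le (B * 2 ^ t) s'"
  using assms
proof (induction arbitrary: B rule: exec.induct)
  case (Seq c s t s' d u s'')
  have "state_le (B * 2 ^ t) s'" "consts_le (B * 2 ^ t) d"
    using Seq by (auto intro: consts_le_mono)
  from Seq.IH(2)[OF this(2,1)] show ?case
    by (simp add: power_add mult.assoc)
next
  case (Cond_True r i c h t s' d)
  then have "state_le (B * 2 ^ t) s'" by auto
  then show ?case by (rule state_le_mono) simp
next
  case (Cond_False r i d h t s' c)
  then have "state_le (B * 2 ^ t) s'" by auto
  then show ?case by (rule state_le_mono) simp
next
  case (While_True r i c h t s' u s'')
  have "state_le (B * 2 ^ t) s'" "consts_le (B * 2 ^ t) (While i c)"
    using While_True by (auto intro: consts_le_mono)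
  from While_True.IH(2)[OF this(2,1)] show ?case
    by (rule state_le_mono) (simp add: power_add mult.assoc)
next
  case (Add i j k r h)
  then have "r j \<le> B" "r k \<le> B" by (auto simp: state_le_def)
  then have "r j + r k \<le> B * 2" by linarith
  moreover have "state_le (B * 2) (r, h)" by (rule state_le_mono[OF Add.prems(2)]) simp
  ultimately show ?case by (simp add: state_le_def)
next
  case (Sub i j k r h)
  then have "r j \<le> B" by (auto simp: state_le_def)
  then have "r j - r k \<le> B * 2" by linarith
  moreover have "state_le (B * 2) (r, h)" by (rule state_le_mono[OF Sub.prems(2)]) simp
  ultimately show ?case by (simp add: state_le_def)
next
  case (Const i k r h)
  have "state_le (B * 2) (r, h)" by (rule state_le_mono[OF Const.prems(2)]) simp
  with Const show ?case by (simp add: state_le_def)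
next
  case (Load i j r h)
  have "state_le (B * 2) (r, h)" by (rule state_le_mono[OF Load.prems(2)]) simp
  then show ?case by (simp add: state_le_def)
next
  case (Store i j r h)
  have "state_le (B * 2) (r, h)" by (rule state_le_mono[OF Store.prems(2)]) simp
  then show ?case by (simp add: state_le_def)
next
  case (While_False r i c h)
  show ?case by (rule state_le_mono[OF While_False.prems(2)]) simp
qed

text \<open>
  Register 0 holds \<open>m\<close>, register 1 holds \<open>n\<close>, and memory cell \<open>j\<close> holds the height of the
  \<open>j\<close>-th column of the Young diagram \<open>Z\<close> (which is zero for \<open>j \<ge> n\<close> if \<open>Z \<subseteq> rect n m\<close>).
  A zero-set with finite columns is determined by its column heights.  All other registers are
  initially zero.
\<close>

definition initial :: "nat \<Rightarrow> nat \<Rightarrow> (nat \<times> nat) set \<Rightarrow> state" where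
  "initial m n Z = ((\<lambda>_. 0)(0 := m, 1 := n), (\<lambda>j. card {i. (j, i) \<in> Z}))"

definition result :: "state \<Rightarrow> nat" where
  "result s = fst s 0"

end

theory Submission
  imports Defs
begin

text \<open>
  Let \<open>h a\<close> be the height of column \<open>a\<close> of \<open>Z\<close>.  The algorithm returns the minimum of
  \<open>m a + n h a\<close> over \<open>a \<le> n\<close>.  This is at least \<open>\<gamma>\<close>, since \<open>a\<close> full columns together with
  \<open>h a\<close> full rows give every vertex counts \<open>(r, c)\<close> with \<open>r \<ge> a\<close> and \<open>c \<ge> h a\<close>.
  Conversely, take an optimal set \<open>A\<close> and a row meeting \<open>A\<close> in the least number \<open>a\<close> of points,
  so \<open>m a \<le> \<gamma>\<close>.  Each of the \<open>n - a\<close> columns where this row misses \<open>A\<close> contains at least \<open>h a\<close>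
  points of \<open>A\<close>, so \<open>(n - a) h a \<le> \<gamma>\<close>.  If \<open>2 a \<le> n\<close>, then \<open>m a + n h a \<le> 3 \<gamma>\<close>; otherwise the
  value \<open>m n\<close> at \<open>a = n\<close> is at most \<open>2 \<gamma>\<close>.
\<close>

section \<open>Domination by full rows and columns\<close>

text \<open>By the form of \<open>initial\<close>, \<open>height Z\<close> is exactly the initial
  memory of the machine.\<close>

definition height :: "(nat \<times> nat) set \<Rightarrow> nat \<Rightarrow> nat" where
  "height Z a = card {i. (a, i) \<in> Z}"

text \<open>The size of a cross of \<open>a\<close> full columns and \<open>height Z a\<close> full
  rows, with the overlap counted twice.\<close>

definition cross_cost :: "(nat \<times> nat) set \<Rightarrow> nat \<Rightarrow> nat \<Rightarrow> nat \<Rightarrow> nat" where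
  "cross_cost Z m n a = m * a + n * height Z a"

lemma height_le:
  assumes "Z \<subseteq> rect n m"
  shows "height Z a \<le> m"
proof -
  have "{i. (a, i) \<in> Z} \<subseteq> {..<m}"
    using assms by (auto simp: rect_def)
  from card_mono[OF _ this] show ?thesis by (simp add: height_def)
qed

lemma height_beyond:
  assumes "Z \<subseteq> rect n m" and "n \<le> a"
  shows "height Z a = 0"
proof -
  have "{i. (a, i) \<in> Z} = {}"
    using assms by (auto simp: rect_def)
  then show ?thesis by (simp add: height_def)
qed

text \<open>Downward closure makes each column an initial segment; containment in the rectangle
  makes it finite.\<close>

lemma in_zero_set_iff:
  assumes "zero_set Z" and "Z \<subseteq> rect n m"
  shows "(a, c) \<in> Z \<longleftrightarrow> c < height Z a"
proof -
  have fin: "finite {i. (a, i) \<in> Z}"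
    by (rule finite_subset[of _ "{..<m}"]) (use assms(2) in \<open>auto simp: rect_def\<close>)
  show ?thesis
  proof
    assume "(a, c) \<in> Z"
    then have "{..c} \<subseteq> {i. (a, i) \<in> Z}"
      using assms(1) by (auto simp: zero_set_def)
    from card_mono[OF fin this] show "c < height Z a" by (simp add: height_def)
  next
    assume less: "c < height Z a"
    show "(a, c) \<in> Z"
    proof (rule ccontr)
      assume "(a, c) \<notin> Z"
      then have "i < c" if "(a, i) \<in> Z" for i
        using assms(1) that unfolding zero_set_def by (meson leI order_refl)
      then have "{i. (a, i) \<in> Z} \<subseteq> {..<c}" by auto
      from card_mono[OF _ this] less show False by (simp add: height_def)
    qed
  qed
qed

lemma finite_rect [simp]: "finite (rect n m)"
  by (simp add: rect_def)

lemma gamma_le: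
  assumes "A \<subseteq> rect n m" and "growth Z n m A = rect n m"
  shows "gamma Z m n \<le> card A"
  unfolding gamma_def using assms by (intro Min_le gamma_set(1) imageI) simp

lemma gamma_attained:
  obtains A where "A \<subseteq> rect n m" "growth Z n m A = rect n m" "card A = gamma Z m n"
proof -
  have "gamma Z m n \<in> card ` {A. A \<subseteq> rect n m \<and> growth Z n m A = rect n m}"
    unfolding gamma_def by (rule Min_in[OF gamma_set])
  then show ?thesis by (elim imageE CollectE conjE) (rule that, simp_all)
qed

lemma gamma_le_cross_cost:
  assumes Z: "zero_set Z" "Z \<subseteq> rect n m" and "a \<le> n"
  shows "gamma Z m n \<le> cross_cost Z m n a"
proof -
  define b where "b = height Z a"
  define A where "A = {..<a} \<times> {..<m} \<union> {..<n} \<times> {..<b}"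
  have "b \<le> m" using height_le[OF Z(2)] by (simp add: b_def)
  have sub: "A \<subseteq> rect n m"
    using \<open>a \<le> n\<close> \<open>b \<le> m\<close> by (auto simp: A_def rect_def)
  have "(card (row_nbhd n m v \<inter> A), card (col_nbhd n m v \<inter> A)) \<notin> Z"
    if v: "v \<in> rect n m - A" for v
  proof
    assume in_Z: "(card (row_nbhd n m v \<inter> A), card (col_nbhd n m v \<inter> A)) \<in> Z"
    obtain j i where ji: "v = (j, i)" by (cases v)
    \<comment> \<open>Outside \<open>A\<close>, the vertex lies in none of the \<open>a\<close> full
      columns, so each of them contributes a point of its row different from
      \<open>v\<close>.\<close>
    have "(\<lambda>j'. (j', i)) ` {..<a} \<subseteq> row_nbhd n m v \<inter> A"
      using v \<open>a \<le> n\<close> by (auto simp: ji row_nbhd_def rect_def A_def)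
    then have "card ((\<lambda>j'. (j', i)) ` {..<a}) \<le> card (row_nbhd n m v \<inter> A)"
      by (rule card_mono[rotated]) (simp add: row_nbhd_def)
    then have row: "a \<le> card (row_nbhd n m v \<inter> A)"
      by (simp add: card_image inj_on_def)
    have "(\<lambda>i'. (j, i')) ` {..<b} \<subseteq> col_nbhd n m v \<inter> A"
      using v \<open>b \<le> m\<close> by (auto simp: ji col_nbhd_def rect_def A_def)
    then have "card ((\<lambda>i'. (j, i')) ` {..<b}) \<le> card (col_nbhd n m v \<inter> A)"
      by (rule card_mono[rotated]) (simp add: col_nbhd_def)
    then have col: "b \<le> card (col_nbhd n m v \<inter> A)"
      by (simp add: card_image inj_on_def)
    from in_Z row col Z(1) have "(a, b) \<in> Z"
      unfolding zero_set_def by blast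
    then show False by (simp add: in_zero_set_iff[OF Z] b_def)
  qed
  then have "growth Z n m A = rect n m"
    using sub by (auto simp: growth_def)
  then have "gamma Z m n \<le> card A"
    by (rule gamma_le[OF sub])
  also have "card A \<le> a * m + n * b"
    unfolding A_def by (rule order_trans[OF card_Un_le]) simp
  finally show ?thesis by (simp add: cross_cost_def b_def mult.commute)
qed

lemma cross_cost_le_3_gamma:
  assumes Z: "zero_set Z" "Z \<subseteq> rect n m" and "1 \<le> m"
  shows "\<exists>a\<le>n. cross_cost Z m n a \<le> 3 * gamma Z m n"
proof -
  obtain A where A: "A \<subseteq> rect n m" "growth Z n m A = rect n m" "card A = gamma Z m n"
    by (rule gamma_attained)
  define row where "row i = {j. (j, i) \<in> A}" for i
  define col where "col j = {i. (j, i) \<in> A}" for j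
  have row_sub: "row i \<subseteq> {..<n}" for i
    using A(1) by (auto simp: row_def rect_def)
  have col_sub: "col j \<subseteq> {..<m}" for j
    using A(1) by (auto simp: col_def rect_def)
  have fin_row: "finite (row i)" for i by (rule finite_subset[OF row_sub]) simp
  have fin_col: "finite (col j)" for j by (rule finite_subset[OF col_sub]) simp
  \<comment> \<open>\<open>Sigma\<close> groups by first coordinate, so the relation is transposed
    to count by rows.\<close>
  have "A\<inverse> = Sigma {..<m} row"
    using A(1) by (auto simp: row_def rect_def)
  then have "card A = card (Sigma {..<m} row)"
    by (metis card_inverse)
  then have card_rows: "card A = (\<Sum>i<m. card (row i))"
    using fin_row by simp
  have "A = Sigma {..<n} col"
    using A(1) by (auto simp: col_def rect_def)
  then have card_cols: "card A = (\<Sum>j<n. card (col j))"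
    using fin_col by simp

  \<comment> \<open>\<open>1 \<le> m\<close> supplies a row, so the minimum is attained.\<close>
  obtain i where i: "i < m" and min: "\<And>i'. i' < m \<Longrightarrow> card (row i) \<le> card (row i')"
    using ex_has_least_nat[of "\<lambda>i. i < m" 0 "\<lambda>i. card (row i)"] \<open>1 \<le> m\<close> by auto
  define a where "a = card (row i)"
  have "a \<le> n"
    using card_mono[OF _ row_sub[of i]] by (simp add: a_def)
  have ma: "m * a \<le> gamma Z m n"
    using sum_bounded_below[of "{..<m}" a "\<lambda>i. card (row i)"] min card_rows A(3)
    by (simp add: a_def)
  \<comment> \<open>Since \<open>(j, i)\<close> is outside \<open>A\<close>, growth must add it, so
    its counts \<open>(a, card (col j))\<close> avoid \<open>Z\<close>.\<close>
  have col_height: "height Z a \<le> card (col j)" if "j \<in> {..<n} - row i" for j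
  proof -
    have v: "(j, i) \<in> rect n m" "(j, i) \<notin> A"
      using that i by (auto simp: rect_def row_def)
    have "row_nbhd n m (j, i) \<inter> A = (\<lambda>j'. (j', i)) ` row i"
      using v A(1) by (auto simp: row_nbhd_def row_def)
    then have r: "card (row_nbhd n m (j, i) \<inter> A) = a"
      by (simp add: card_image inj_on_def a_def)
    have "col_nbhd n m (j, i) \<inter> A = (\<lambda>i'. (j, i')) ` col j"
      using v A(1) by (auto simp: col_nbhd_def col_def)
    then have c: "card (col_nbhd n m (j, i) \<inter> A) = card (col j)"
      by (simp add: card_image inj_on_def)
    have "(j, i) \<in> growth Z n m A" using v A(2) by simp
    then have "(a, card (col j)) \<notin> Z"
      using v by (simp add: growth_def r c)
    then show ?thesis by (simp add: in_zero_set_iff[OF Z])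
  qed
  have "(n - a) * height Z a = card ({..<n} - row i) * height Z a"
    by (simp add: card_Diff_subset fin_row row_sub a_def)
  also have "\<dots> \<le> (\<Sum>j\<in>{..<n} - row i. card (col j))"
    using sum_bounded_below[of "{..<n} - row i" "height Z a" "\<lambda>j. card (col j)"] col_height
    by simp
  also have "\<dots> \<le> (\<Sum>j<n. card (col j))"
    by (rule sum_mono2) auto
  finally have nh: "(n - a) * height Z a \<le> gamma Z m n"
    using card_cols A(3) by simp
  show ?thesis
  proof (cases "2 * a \<le> n")
    case True
    then have "n * height Z a \<le> (2 * (n - a)) * height Z a"
      by (intro mult_right_mono) auto
    also have "\<dots> \<le> 2 * gamma Z m n"
      using nh by (simp add: mult.assoc)
    finally have "cross_cost Z m n a \<le> 3 * gamma Z m n"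
      using ma by (simp add: cross_cost_def)
    with \<open>a \<le> n\<close> show ?thesis by blast
  next
    case False
    then have "m * n \<le> m * (2 * a)"
      by (intro mult_left_mono) auto
    also have "\<dots> \<le> 3 * gamma Z m n"
      using ma by simp
    finally have "cross_cost Z m n n \<le> 3 * gamma Z m n"
      by (simp add: cross_cost_def height_beyond[OF Z(2)])
    then show ?thesis by blast
  qed
qed

section \<open>Running times of random access machine programs\<close>

text \<open>Total correctness with a time budget. Exhibiting one run suffices, since by
  \<open>exec_deterministic\<close> it is the only one.\<close>

definition runs :: "prog \<Rightarrow> state \<Rightarrow> nat \<Rightarrow> (state \<Rightarrow> bool) \<Rightarrow> bool" where
  "runs c s T Q \<longleftrightarrow> (\<exists>t s'. exec c s t s' \<and> t \<le> T \<and> Q s')"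

lemma runs_basic:
  "Q (r(i := k), h) \<Longrightarrow> runs (Const i k) (r, h) 1 Q"
  "Q (r(i := r j + r k), h) \<Longrightarrow> runs (Add i j k) (r, h) 1 Q"
  "Q (r(i := r j - r k), h) \<Longrightarrow> runs (Sub i j k) (r, h) 1 Q"
  "Q (r(i := h (r j)), h) \<Longrightarrow> runs (Load i j) (r, h) 1 Q"
  unfolding runs_def by (blast intro: exec.intros)+

text \<open>Nesting the second assertion in the first postcondition turns repeated introduction into
  symbolic execution.\<close>

lemma runs_Seq:
  assumes "runs c s T (\<lambda>s'. runs d s' U Q)"
  shows "runs (Seq c d) s (T + U) Q"
  using assms unfolding runs_def by (meson add_mono exec.Seq)

lemma runs_mono:
  assumes "runs c s T Q" and "T \<le> U" and "\<And>s. Q s \<Longrightarrow> R s"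
  shows "runs c s U R"
  using assms unfolding runs_def by (meson order_trans)

text \<open>\<open>P k\<close> is the invariant with \<open>k\<close> rounds left, a number that the
  tested register holds. Each round costs the body and one test; the final 1 is the failing
  test.\<close>

lemma runs_While:
  assumes body: "\<And>k r h. P (Suc k) (r, h) \<Longrightarrow> runs c (r, h) T (P k)"
    and counter: "\<And>k r h. P k (r, h) \<Longrightarrow> r i = k"
  shows "P k s \<Longrightarrow> runs (While i c) s (k * (T + 1) + 1) (P 0)"
proof (induction k arbitrary: s)
  case 0
  obtain r h where "s = (r, h)" by (cases s)
  with 0 counter[of 0 r h] have "exec (While i c) s 1 s"
    by (blast intro: exec.While_False)
  with 0 show ?case unfolding runs_def by fastforce
next
  case (Suc k)
  obtain r h where s: "s = (r, h)" by (cases s)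
  with Suc.prems body obtain t s' where 1: "exec c (r, h) t s'" "t \<le> T" "P k s'"
    unfolding runs_def by blast
  from Suc.IH[OF 1(3)] obtain u s'' where
    2: "exec (While i c) s' u s''" "u \<le> k * (T + 1) + 1" "P 0 s''"
    unfolding runs_def by blast
  have "r i > 0" using counter[of "Suc k" r h] Suc.prems s by simp
  with 1 2 have "exec (While i c) s (1 + t + u) s''"
    unfolding s by (blast intro: exec.While_True)
  moreover have "1 + t + u \<le> Suc k * (T + 1) + 1" using 1 2 by simp
  ultimately show ?case using 2(3) unfolding runs_def by blast
qed

section \<open>The algorithm\<close>

text \<open>
  Register 2 counts the loops, register 3 holds \<open>m * a\<close> and register 4 the least cost found so
  far.  Register 5 holds the constant 1; register 9 is never written, hence holds 0.
  The minimum of \<open>x\<close> and \<open>y\<close> is computed as \<open>x - (x - y)\<close>.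
\<close>

definition add_rows :: prog where
  "add_rows = While 7 (Seq (Add 6 6 1) (Sub 7 7 5))"

text \<open>Going down from \<open>n\<close>, register 2 serves both as loop counter and as address
  of the column read, and \<open>m * a\<close> is updated by one subtraction.\<close>

definition cross_step :: prog where
  "cross_step = Seq (Sub 2 2 5) (Seq (Sub 3 3 0) (Seq (Add 6 3 9) (Seq (Load 7 2)
     (Seq add_rows (Seq (Sub 8 4 6) (Sub 4 4 8))))))"

definition min_cross :: prog where
  "min_cross = Seq (Const 5 1) (Seq (Add 2 1 9) (Seq (While 2 (Seq (Add 3 3 0) (Sub 2 2 5)))
     (Seq (Add 4 3 9) (Seq (Add 2 1 9) (Seq (While 2 cross_step) (Add 0 4 9))))))"

text \<open>Multiplication by repeated addition; the factor 3 counts one test and two instructions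
  per round.\<close>

lemma runs_add_rows:
  assumes "r 5 = 1"
  shows "runs add_rows (r, h) (3 * r 7 + 1)
           (\<lambda>s. s = (r(6 := r 6 + r 7 * r 1, 7 := 0), h))"
proof -
  define P where "P k s \<longleftrightarrow> s = (r(6 := r 6 + (r 7 - k) * r 1, 7 := k), h) \<and> k \<le> r 7"
    for k and s :: state
  have "runs add_rows (r, h) (r 7 * ((1 + 1) + 1) + 1) (P 0)"
    unfolding add_rows_def
  proof (rule runs_While)
    fix k r' h' assume inv: "P (Suc k) (r', h')"
    then have "r 7 - k = Suc (r 7 - Suc k)" unfolding P_def by linarith
    then have "r 6 + (r 7 - k) * r 1 = r 6 + (r 7 - Suc k) * r 1 + r 1" by simp
    with inv assms show "runs (Seq (Add 6 6 1) (Sub 7 7 5)) (r', h') (1 + 1) (P k)"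
      by (intro runs_Seq runs_basic) (simp add: P_def add.assoc)
  next
    show "P (r 7) (r, h)" by (simp add: P_def)
  next
    show "r' 7 = k" if "P k (r', h')" for k r' h'
      using that by (simp add: P_def)
  qed
  then show ?thesis by (rule runs_mono) (simp_all add: P_def)
qed

text \<open>The bound \<open>k \<le> n\<close> keeps \<open>{k..n}\<close> nonempty, so that
  \<open>Min\<close> is a genuine minimum.\<close>

definition cross_inv :: "(nat \<times> nat) set \<Rightarrow> nat \<Rightarrow> nat \<Rightarrow> nat \<Rightarrow> state \<Rightarrow> bool" where
  "cross_inv Z m n k s \<longleftrightarrow> k \<le> n \<and> snd s = height Z \<and> fst s 0 = m \<and> fst s 1 = n \<and> fst s 2 = k \<and>
     fst s 3 = m * k \<and> fst s 4 = Min (cross_cost Z m n ` {k..n}) \<and> fst s 5 = 1 \<and> fst s 9 = 0"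

lemma runs_cross_step:
  assumes Z: "Z \<subseteq> rect n m" and "m \<le> n" and inv: "cross_inv Z m n (Suc k) (r, h)"
  shows "runs cross_step (r, h) (3 * n + 7) (cross_inv Z m n k)"
proof -
  have "{k..n} = insert k {Suc k..n}"
    using inv by (auto simp: cross_inv_def)
  then have "Min (cross_cost Z m n ` {k..n})
      = min (cross_cost Z m n k) (Min (cross_cost Z m n ` {Suc k..n}))"
    using inv by (simp add: cross_inv_def)
  then have Min_step: "Min (cross_cost Z m n ` {k..n})
      = Min (cross_cost Z m n ` {Suc k..n}) -
        (Min (cross_cost Z m n ` {Suc k..n}) - cross_cost Z m n k)"
    by simp
  have cost: "cross_cost Z m n k = m * k + height Z k * n"
    by (simp add: cross_cost_def)
  let ?r = "r(2 := k, 3 := m * k, 6 := m * k + height Z k * n, 7 := 0)"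
  have "runs (Seq (Sub 8 4 6) (Sub 4 4 8)) (?r, h) (1 + 1) (cross_inv Z m n k)"
    using inv by (intro runs_Seq runs_basic) (simp add: cross_inv_def Min_step cost)
  then have "runs cross_step (r, h)
    (1 + (1 + (1 + (1 + ((3 * height Z k + 1) + (1 + 1)))))) (cross_inv Z m n k)"
    unfolding cross_step_def
    using inv
    by (intro runs_Seq runs_basic, intro runs_mono[OF runs_add_rows])
      (simp_all add: cross_inv_def)
  \<comment> \<open>The multiplication loop makes \<open>height Z k\<close> rounds, at most
    \<open>m \<le> n\<close>.\<close>
  then show ?thesis
    by (rule runs_mono) (use height_le[OF Z, of k] \<open>m \<le> n\<close> in auto)
qed

lemma runs_min_cross:
  assumes Z: "Z \<subseteq> rect n m" and "m \<le> n"
  shows "runs min_cross (initial m n Z) (3 * n ^ 2 + 11 * n + 7)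
           (\<lambda>s. result s = Min (cross_cost Z m n ` {..n}))"
proof -
  \<comment> \<open>Invariant of the first loop, which computes \<open>m * n\<close> by adding
    \<open>m\<close> in each of \<open>n\<close> rounds.\<close>
  define P where "P k s \<longleftrightarrow> k \<le> n \<and> snd s = height Z \<and> fst s 0 = m \<and> fst s 1 = n \<and>
    fst s 2 = k \<and> fst s 3 = m * (n - k) \<and> fst s 5 = 1 \<and> fst s 9 = 0" for k and s :: state
  define c where "c = Seq (Add 3 3 0) (Sub 2 2 5)"
  have loop1: "runs (While 2 c) s (n * ((1 + 1) + 1) + 1) (P 0)" if "P n s" for s
  proof (rule runs_While[where P = P, OF _ _ that])
    fix k r h assume inv: "P (Suc k) (r, h)"
    then have "n - k = Suc (n - Suc k)" unfolding P_def by linarith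
    then have "m * (n - k) = m * (n - Suc k) + m" by simp
    with inv show "runs c (r, h) (1 + 1) (P k)"
      unfolding c_def by (intro runs_Seq runs_basic) (simp add: P_def)
  qed (auto simp: P_def)
  have loop2: "runs (While 2 cross_step) s (n * ((3 * n + 7) + 1) + 1) (cross_inv Z m n 0)"
    if "cross_inv Z m n n s" for s
    by (rule runs_While[where P = "cross_inv Z m n", OF runs_cross_step[OF assms] _ that])
      (simp_all add: cross_inv_def)
  have final: "runs (Add 0 4 9) s 1 (\<lambda>s. result s = Min (cross_cost Z m n ` {..n}))"
    if "cross_inv Z m n 0 s" for s
  proof -
    obtain r h where s: "s = (r, h)" by (cases s)
    show ?thesis
      unfolding s
      by (intro runs_basic)
        (use that s in \<open>simp add: cross_inv_def result_def atLeast0AtMost\<close>)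
  qed
  \<comment> \<open>Register 4 starts with \<open>m * n\<close>, which is the cost at
    \<open>a = n\<close> because column \<open>n\<close> of \<open>Z\<close> is empty.\<close>
  have middle: "runs (Seq (Add 4 3 9) (Seq (Add 2 1 9) (Seq (While 2 cross_step) (Add 0 4 9))))
      s (1 + (1 + ((n * ((3 * n + 7) + 1) + 1) + 1)))
      (\<lambda>s. result s = Min (cross_cost Z m n ` {..n}))"
    if "P 0 s" for s
  proof -
    obtain r h where s: "s = (r, h)" by (cases s)
    show ?thesis
      unfolding s
      by (intro runs_Seq runs_basic, rule runs_mono[OF loop2 order_refl final])
        (use that s in \<open>auto simp: P_def cross_inv_def cross_cost_def height_beyond[OF Z]\<close>)
  qed
  have "runs min_cross (initial m n Z)
      (1 + (1 + ((n * ((1 + 1) + 1) + 1) + (1 + (1 + ((n * ((3 * n + 7) + 1) + 1) + 1))))))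
      (\<lambda>s. result s = Min (cross_cost Z m n ` {..n}))"
    unfolding min_cross_def initial_def c_def[symmetric]
    by (intro runs_Seq[of "Const _ _"] runs_Seq[of "Add _ _ _"] runs_basic, rule runs_Seq,
        rule runs_mono[OF loop1 order_refl middle])
      (auto simp: P_def height_def)
  then show ?thesis
    by (rule runs_mono) (auto simp: power2_eq_square algebra_simps)
qed

theorem theorem1p4:
  "\<exists>(alg :: prog) (p :: nat poly).
     \<forall>(m :: nat) (n :: nat) (Z :: (nat \<times> nat) set).
       1 \<le> m \<longrightarrow> m \<le> n \<longrightarrow> zero_set Z \<longrightarrow> Z \<subseteq> rect n m \<longrightarrow>
         (\<exists>t s. exec alg (initial m n Z) t s \<and> t \<le> poly p n \<and>
                result s \<in> {gamma Z m n .. 3 * gamma Z m n})"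
proof (intro exI[of _ min_cross] exI[of _ "[:7, 11, 3:]"] allI impI)
  fix m n :: nat and Z :: "(nat \<times> nat) set"
  assume m: "1 \<le> m" "m \<le> n" and Z: "zero_set Z" "Z \<subseteq> rect n m"
  let ?C = "cross_cost Z m n ` {..n}"
  obtain t s where run: "exec min_cross (initial m n Z) t s" "t \<le> 3 * n ^ 2 + 11 * n + 7"
    "result s = Min ?C"
    using runs_min_cross[OF Z(2) m(2)] unfolding runs_def by blast
  have "gamma Z m n \<le> Min ?C"
    using gamma_le_cross_cost[OF Z] by (intro Min.boundedI) auto
  moreover obtain a where "a \<le> n" "cross_cost Z m n a \<le> 3 * gamma Z m n"
    using cross_cost_le_3_gamma[OF Z m(1)] by blast
  then have "Min ?C \<le> 3 * gamma Z m n"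
    by (intro Min.coboundedI[THEN order_trans, of _ "cross_cost Z m n a"]) auto
  \<comment> \<open>The coefficients are listed from the constant term upwards.\<close>
  moreover have "t \<le> poly [:7, 11, 3:] n"
    using run(2) by (simp add: power2_eq_square algebra_simps)
  ultimately have "t \<le> poly [:7, 11, 3:] n" "result s \<in> {gamma Z m n .. 3 * gamma Z m n}"
    using run(3) by auto
  with run(1) show "\<exists>t s. exec min_cross (initial m n Z) t s \<and> t \<le> poly [:7, 11, 3:] n \<and>
      result s \<in> {gamma Z m n .. 3 * gamma Z m n}"
    by blast
qed

end
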